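(* Let $G=(V,E)$ be a locally finite, connected weighted graph with uniformly positive measure and symmetric, uniformly bounded weights (precise conditions in the context), and let $\Omega$ be a non-empty, connected and bounded domain in $V$. Then for any $p>2$ the problem $$\Delta^2u-\Delta u+u=|u|^{p-2}u\ \text{ in }\Omega,\qquad u=0\ \text{ on }\partial\Omega,$$ has a ground state solution $u_0\in H(\Omega)$.
   Context: Graph. $G=(V,E)$ is a graph with vertex set $V$ and edge set $E$; $y\sim x$ means $xy\in E$. It is assumed that: each vertex has finitely many neighbours (locally finite); any two vertices can be joined by finitely many edges (connected); there is a measure $\mu:V\to(0,\infty)$ and a constant $\mu_{\min}>0$ with $\mu(x)\ge\mu_{\min}$ for all $x\in V$; each edge $xy$ has a positive weight $\omega_{xy}=\omega_{yx}$, and there is a constant $C$ with $\sum_{y\sim x}\omega_{xy}<C$ for all $x\in V$. $d(x,y)$ is the minimal number of edges connecting $x$ and $y$. A subset $\Omega\subset V$ is a bounded domain if $d(x,y)$ is uniformly bounded for $x,y\in\Omega$ (so $\Omega$ is finite). Its boundary is $\partial\Omega=\{y\in V\setminus\Omega:\exists x\in\Omega,\ xy\in E\}$. Operators. For $u,v:V\to\mathbb R$: $\Delta u(x)=\frac1{\mu(x)}\sum_{y\sim x}\omega_{xy}(u(y)-u(x))$; $\Delta^2u=\Delta(\Delta u)$; $\nabla u\nabla v(x)=\frac1{2\mu(x)}\sum_{y\sim x}\omega_{xy}(u(y)-u(x))(v(y)-v(x))$; $|\nabla u|^2=\nabla u\nabla u$; $\int_A u\,d\mu=\sum_{x\in A}\mu(x)u(x)$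 for $A\subset V$. Spaces. $W^{2,2}(\Omega)$ is the set of functions $u:V\to\mathbb R$ under the norm $\left(\int_{\Omega\cup\partial\Omega}(|\Delta u|^2+|\nabla u|^2)d\mu+\int_\Omega u^2d\mu\right)^{1/2}$. $W^{1,2}_0(\Omega)$ is the completion of $C_c(\Omega)$ under $\left(\int_{\Omega\cup\partial\Omega}|\nabla u|^2d\mu+\int_\Omega u^2d\mu\right)^{1/2}$, where $C_c(\Omega)$ is the set of functions $u$ with support in $\Omega$ and $u=0$ on $\partial\Omega$. $H(\Omega)=W^{2,2}(\Omega)\cap W^{1,2}_0(\Omega)$; its elements are regarded as functions on $V$ vanishing outside $\Omega$. Inner product: $(u,v)_{H(\Omega)}=\int_{\Omega\cup\partial\Omega}(\Delta u\Delta v+\nabla u\nabla v)d\mu+\int_\Omega uv\,d\mu$. Variational notions. On $H(\Omega)$, $J_\Omega(u)=\frac12\int_{\Omega\cup\partial\Omega}(|\Delta u|^2+|\nabla u|^2)d\mu+\frac12\int_\Omega u^2d\mu-\frac1p\int_\Omega|u|^pd\mu$; $\mathcal N_\Omega=\{u\in H(\Omega)\setminus\{0\}:J_\Omega'(u)u=0\}$; $m_\Omega=\inf_{\mathcal N_\Omega}J_\Omega$. A weak solution is $u\in H(\Omega)$ with $\int_{\Omega\cup\partial\Omega}(\Delta u\Delta\phi+\nabla u\nabla\phi)d\mu+\int_\Omega u\phi\,d\mu=\int_\Omega|u|^{p-2}u\phi\,d\mu$ for all $\phi\in H(\Omega)$. A ground state solution is a $u_0\in\mathcal N_\Omega$ with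 $J_\Omega(u_0)=m_\Omega$ which is a critical point of $J_\Omega$, i.e. a weak solution. *)

theory Defs
  imports "HOL-Analysis.Analysis"
begin

text \<open>
  A function on the vertex set \<open>V\<close> is represented by a total function on the ambient type that is 0
  off \<open>V\<close>, so that equality of functions on \<open>V\<close> is equality in HOL. Edges are unordered pairs;
  loops are not excluded (they do not contribute to any of the operators below).
\<close>

locale weighted_graph =
  fixes V :: "'a set"
    and E :: "'a set set"
    and \<mu> :: "'a \<Rightarrow> real"
    and \<omega> :: "'a \<Rightarrow> 'a \<Rightarrow> real"
  assumes edges: "e \<in> E \<Longrightarrow> \<exists>x\<in>V. \<exists>y\<in>V. e = {x, y}"
    and locally_finite: "x \<in> V \<Longrightarrow> finite {y. {x, y} \<in> E}"
    and connected: "x \<in> V \<Longrightarrow> y \<in> V \<Longrightarrow> (x, y) \<in> {(a, b). {a, b} \<in> E}\<^sup>*"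
    and measure_bound: "\<exists>\<mu>min>0. \<forall>x\<in>V. \<mu> x \<ge> \<mu>min"
    and weight_pos: "{x, y} \<in> E \<Longrightarrow> \<omega> x y > 0"
    and weight_sym: "{x, y} \<in> E \<Longrightarrow> \<omega> x y = \<omega> y x"
    and weight_bound: "\<exists>C. \<forall>x\<in>V. (\<Sum>y | {x, y} \<in> E. \<omega> x y) < C"
begin

definition gdist :: "'a \<Rightarrow> 'a \<Rightarrow> nat" where
  "gdist x y = (LEAST n. (x, y) \<in> {(a, b). {a, b} \<in> E} ^^ n)"

definition bounded_domain :: "'a set \<Rightarrow> bool" where
  "bounded_domain \<Omega> \<longleftrightarrow> \<Omega> \<subseteq> V \<and> (\<exists>K. \<forall>x\<in>\<Omega>. \<forall>y\<in>\<Omega>. gdist x y \<le> K)"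

text \<open>Connectedness of the subgraph induced on \<open>\<Omega>\<close>: the paths have to stay inside \<open>\<Omega>\<close>.\<close>
definition connected_domain :: "'a set \<Rightarrow> bool" where
  "connected_domain \<Omega> \<longleftrightarrow>
     (\<forall>x\<in>\<Omega>. \<forall>y\<in>\<Omega>. (x, y) \<in> {(a, b). a \<in> \<Omega> \<and> b \<in> \<Omega> \<and> {a, b} \<in> E}\<^sup>*)"

definition bdry :: "'a set \<Rightarrow> 'a set" where
  "bdry \<Omega> = {y \<in> V - \<Omega>. \<exists>x\<in>\<Omega>. {x, y} \<in> E}"

definition lap :: "('a \<Rightarrow> real) \<Rightarrow> 'a \<Rightarrow> real" where
  "lap u x = 1 / \<mu> x * (\<Sum>y | {x, y} \<in> E. \<omega> x y * (u y - u x))"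

definition grad_prod :: "('a \<Rightarrow> real) \<Rightarrow> ('a \<Rightarrow> real) \<Rightarrow> 'a \<Rightarrow> real" where
  "grad_prod u v x =
     1 / (2 * \<mu> x) * (\<Sum>y | {x, y} \<in> E. \<omega> x y * (u y - u x) * (v y - v x))"

definition grad_sq :: "('a \<Rightarrow> real) \<Rightarrow> 'a \<Rightarrow> real" where
  "grad_sq u = grad_prod u u"

definition integ :: "'a set \<Rightarrow> ('a \<Rightarrow> real) \<Rightarrow> real" where
  "integ A u = (\<Sum>\<^sub>\<infinity>x\<in>A. \<mu> x * u x)"

definition vfuns :: "('a \<Rightarrow> real) set" where
  "vfuns = {u. \<forall>x. x \<notin> V \<longrightarrow> u x = 0}"

text \<open>The functions of finite norm; for a bounded domain this is no restriction.\<close>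
definition W22 :: "'a set \<Rightarrow> ('a \<Rightarrow> real) set" where
  "W22 \<Omega> = {u \<in> vfuns.
     (\<lambda>x. \<mu> x * ((lap u x)\<^sup>2 + grad_sq u x)) summable_on (\<Omega> \<union> bdry \<Omega>) \<and>
     (\<lambda>x. \<mu> x * (u x)\<^sup>2) summable_on \<Omega>}"

definition Cc :: "'a set \<Rightarrow> ('a \<Rightarrow> real) set" where
  "Cc \<Omega> = {u \<in> vfuns. {x \<in> V. u x \<noteq> 0} \<subseteq> \<Omega> \<and> (\<forall>x\<in>bdry \<Omega>. u x = 0)}"

definition norm_W12 :: "'a set \<Rightarrow> ('a \<Rightarrow> real) \<Rightarrow> real" where
  "norm_W12 \<Omega> u =
     sqrt (integ (\<Omega> \<union> bdry \<Omega>) (grad_sq u) + integ \<Omega> (\<lambda>x. (u x)\<^sup>2))"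

text \<open>
  The completion of \<open>Cc \<Omega>\<close>, realised inside the functions vanishing outside \<open>\<Omega>\<close> as the limits
  of sequences in \<open>Cc \<Omega>\<close>.
\<close>
definition W12_0 :: "'a set \<Rightarrow> ('a \<Rightarrow> real) set" where
  "W12_0 \<Omega> = {u \<in> vfuns. (\<forall>x. x \<notin> \<Omega> \<longrightarrow> u x = 0) \<and>
     (\<exists>\<phi> :: nat \<Rightarrow> 'a \<Rightarrow> real. (\<forall>n. \<phi> n \<in> Cc \<Omega>) \<and>
        (\<lambda>n. norm_W12 \<Omega> (\<lambda>x. \<phi> n x - u x)) \<longlonglongrightarrow> 0)}"

definition H :: "'a set \<Rightarrow> ('a \<Rightarrow> real) set" where
  "H \<Omega> = W22 \<Omega> \<inter> W12_0 \<Omega>"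

definition inner_H :: "'a set \<Rightarrow> ('a \<Rightarrow> real) \<Rightarrow> ('a \<Rightarrow> real) \<Rightarrow> real" where
  "inner_H \<Omega> u v =
     integ (\<Omega> \<union> bdry \<Omega>) (\<lambda>x. lap u x * lap v x + grad_prod u v x) + integ \<Omega> (\<lambda>x. u x * v x)"

definition norm_H :: "'a set \<Rightarrow> ('a \<Rightarrow> real) \<Rightarrow> real" where
  "norm_H \<Omega> u = sqrt (inner_H \<Omega> u u)"

definition J :: "'a set \<Rightarrow> real \<Rightarrow> ('a \<Rightarrow> real) \<Rightarrow> real" where
  "J \<Omega> p u =
     1 / 2 * integ (\<Omega> \<union> bdry \<Omega>) (\<lambda>x. (lap u x)\<^sup>2 + grad_sq u x)
     + 1 / 2 * integ \<Omega> (\<lambda>x. (u x)\<^sup>2)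
     - 1 / p * integ \<Omega> (\<lambda>x. \<bar>u x\<bar> powr p)"

text \<open>
  \<open>has_H_derivative \<Omega> F L u\<close>: the bounded linear functional \<open>L\<close> on the Hilbert space \<open>H \<Omega>\<close> is the
  Frechet derivative \<open>F'(u)\<close>. The library notion \<open>has_derivative\<close> does not apply because
  \<open>H \<Omega>\<close> is a set and not a normed type.
\<close>
definition has_H_derivative ::
  "'a set \<Rightarrow> (('a \<Rightarrow> real) \<Rightarrow> real) \<Rightarrow> (('a \<Rightarrow> real) \<Rightarrow> real) \<Rightarrow> ('a \<Rightarrow> real) \<Rightarrow> bool" where
  "has_H_derivative \<Omega> F L u \<longleftrightarrow>
     (\<forall>v\<in>H \<Omega>. \<forall>w\<in>H \<Omega>. L (\<lambda>x. v x + w x) = L v + L w) \<and>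
     (\<forall>c. \<forall>v\<in>H \<Omega>. L (\<lambda>x. c * v x) = c * L v) \<and>
     (\<exists>K. \<forall>v\<in>H \<Omega>. \<bar>L v\<bar> \<le> K * norm_H \<Omega> v) \<and>
     (\<forall>\<epsilon>>0. \<exists>\<delta>>0. \<forall>h\<in>H \<Omega>. norm_H \<Omega> h < \<delta> \<longrightarrow>
        \<bar>F (\<lambda>x. u x + h x) - F u - L h\<bar> \<le> \<epsilon> * norm_H \<Omega> h)"

definition nehari :: "'a set \<Rightarrow> real \<Rightarrow> ('a \<Rightarrow> real) set" where
  "nehari \<Omega> p = {u \<in> H \<Omega> - {\<lambda>_. 0}. \<exists>L. has_H_derivative \<Omega> (J \<Omega> p) L u \<and> L u = 0}"

definition ground_level :: "'a set \<Rightarrow> real \<Rightarrow> real" where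
  "ground_level \<Omega> p = (INF u\<in>nehari \<Omega> p. J \<Omega> p u)"

definition critical_point :: "'a set \<Rightarrow> real \<Rightarrow> ('a \<Rightarrow> real) \<Rightarrow> bool" where
  "critical_point \<Omega> p u \<longleftrightarrow> u \<in> H \<Omega> \<and> has_H_derivative \<Omega> (J \<Omega> p) (\<lambda>_. 0) u"

text \<open>
  Weak solutions of \<open>\<Delta>\<^sup>2 u - \<Delta> u + u = |u|\<^bsup>p-2\<^esup> u\<close> in \<open>\<Omega>\<close>; the boundary condition is part of
  \<open>u \<in> H \<Omega>\<close>.
\<close>
definition weak_solution :: "'a set \<Rightarrow> real \<Rightarrow> ('a \<Rightarrow> real) \<Rightarrow> bool" where
  "weak_solution \<Omega> p u \<longleftrightarrow> u \<in> H \<Omega> \<and>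
     (\<forall>\<phi>\<in>H \<Omega>.
        integ (\<Omega> \<union> bdry \<Omega>) (\<lambda>x. lap u x * lap \<phi> x + grad_prod u \<phi> x)
        + integ \<Omega> (\<lambda>x. u x * \<phi> x)
        = integ \<Omega> (\<lambda>x. \<bar>u x\<bar> powr (p - 2) * u x * \<phi> x))"

definition ground_state_solution :: "'a set \<Rightarrow> real \<Rightarrow> ('a \<Rightarrow> real) \<Rightarrow> bool" where
  "ground_state_solution \<Omega> p u \<longleftrightarrow>
     u \<in> nehari \<Omega> p \<and> J \<Omega> p u = ground_level \<Omega> p \<and> critical_point \<Omega> p u \<and> weak_solution \<Omega> p u"

end

end

theory Submission
  imports Defs
begin

text \<open>
  A bounded domain is finite, so \<open>H \<Omega>\<close> consists of all functions supported in \<open>\<Omega>\<close>. With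
  \<open>B\<close> the inner product of \<open>H \<Omega>\<close> and \<open>P u = \<integral>|u|\<^sup>p\<close>, let \<open>v\<close> maximise \<open>P\<close> on the compact
  sphere \<open>B v v = 1\<close> and put \<open>S = P v\<close>. By homogeneity, \<open>P w \<le> S (B w w)\<^bsup>p/2\<^esup>\<close> for all \<open>w\<close>;
  since equality holds at \<open>v\<close>, the first variation of the difference vanishes there, i.e.
  \<open>\<integral>|v|\<^bsup>p-2\<^esup> v \<phi> = S B(v, \<phi>)\<close>. Scaling \<open>v\<close> by \<open>t\<close> with \<open>t\<^bsup>p-2\<^esup> = 1/S\<close> gives a weak solution.
  On the Nehari set \<open>J w = (1/2 - 1/p) B w w\<close> and \<open>B w w = P w\<close>, so the same inequality shows
  that \<open>t v\<close> has least energy. No Lagrange multiplier on the Nehari set is needed.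
\<close>

section \<open>Scalar calculus: the function |t|^p\<close>

text \<open>At 0 the difference quotient has absolute value |h|^(p-1), which tends to 0. Elsewhere
  |t| agrees near \<open>a\<close> with the linear function \<open>t * sgn a\<close>, so the rule
  for powers of a positive base applies. The derivative is written in the form of the nonlinearity
  of the equation.\<close>

lemma has_real_derivative_abs_powr:
  fixes a p :: real
  assumes "p > 2"
  shows "((\<lambda>t. \<bar>t\<bar> powr p) has_real_derivative p * (\<bar>a\<bar> powr (p - 2) * a)) (at a)"
proof (cases "a = 0")
  case True
  have "((\<lambda>h. \<bar>h\<bar> powr (p - 1)) \<longlongrightarrow> 0) (at (0::real))"
    using assms by (intro tendsto_eq_intros | simp)+
  moreover have "(\<bar>h\<bar> powr p) / \<bar>h\<bar> = \<bar>h\<bar> powr (p - 1)" if "h \<noteq> 0" for h :: real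
    using that by (simp add: powr_diff)
  ultimately have "((\<lambda>h. (\<bar>h\<bar> powr p) / \<bar>h\<bar>) \<longlongrightarrow> 0) (at (0::real))"
    by (rule_tac Lim_transform_eventually) (auto simp: eventually_at_filter)
  then have "((\<lambda>h. (\<bar>h\<bar> powr p) / h) \<longlongrightarrow> 0) (at (0::real))"
    by (rule_tac tendsto_rabs_zero_cancel) (simp add: abs_mult)
  then show ?thesis
    using True by (simp add: DERIV_def)
next
  case False
  have "((\<lambda>t. (t * sgn a) powr p) has_real_derivative p * (\<bar>a\<bar> powr (p - 2) * a)) (at a)"
  proof -
    have pos: "a * sgn a > 0"
      using False by (simp add: abs_sgn[symmetric])
    have "\<bar>a\<bar> powr (p - 1) * sgn a = \<bar>a\<bar> powr (p - 2) * a"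
    proof -
      have "\<bar>a\<bar> powr (p - 1) = \<bar>a\<bar> powr (p - 2) * \<bar>a\<bar>"
        using False powr_add[of "\<bar>a\<bar>" "p - 2" 1] by simp
      then show ?thesis
        by (simp add: sgn_if abs_if)
    qed
    then show ?thesis
      using pos
      by (auto intro!: derivative_eq_intros simp: abs_sgn[symmetric] mult.assoc)
  qed
  moreover have ev: "\<forall>\<^sub>F t in nhds a. (t * sgn a) powr p = \<bar>t\<bar> powr p"
  proof (cases "a > 0")
    case True
    then have "\<forall>\<^sub>F t in nhds a. t > 0"
      by (simp add: eventually_nhds_in_open[of "{0<..}", simplified])
    then show ?thesis
      by eventually_elim (use True in simp)
  next
    case nonpos: False
    then have "\<forall>\<^sub>F t in nhds a. t < 0"
      using False by (simp add: eventually_nhds_in_open[of "{..<0}", simplified])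
    then show ?thesis
      by eventually_elim (use nonpos False in simp)
  qed
  ultimately show ?thesis
    using DERIV_cong_ev[OF refl ev refl] by blast
qed

context weighted_graph
begin

section \<open>Bounded domains are finite\<close>

lemma edge_vertex: "{x, y} \<in> E \<Longrightarrow> y \<in> V"
  using edges by (metis insertCI doubleton_eq_iff)

lemma \<mu>_pos: "x \<in> V \<Longrightarrow> \<mu> x > 0"
  using measure_bound by (meson less_le_trans)

lemma bdry_subset: "bdry \<Omega> \<subseteq> V"
  by (auto simp: bdry_def)

text \<open>Induction on the length of the walk. The inclusion in \<open>V\<close> is carried along
  because \<open>locally_finite\<close> speaks of vertices only.\<close>

lemma finite_relpow_reach:
  assumes "x \<in> V"
  shows "finite {y. (x, y) \<in> {(a, b). {a, b} \<in> E} ^^ n} \<and>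
         {y. (x, y) \<in> {(a, b). {a, b} \<in> E} ^^ n} \<subseteq> V"
proof (induction n)
  case 0
  then show ?case using assms by simp
next
  case (Suc n)
  have "{y. (x, y) \<in> {(a, b). {a, b} \<in> E} ^^ Suc n} =
        (\<Union>z\<in>{z. (x, z) \<in> {(a, b). {a, b} \<in> E} ^^ n}. {y. {z, y} \<in> E})"
    by auto
  then show ?case
    using Suc locally_finite edge_vertex by auto
qed

text \<open>Around any one of its points, the domain is covered by finitely many distance spheres,
  each finite by local finiteness.\<close>

lemma bounded_domain_finite:
  assumes "bounded_domain \<Omega>"
  shows "finite \<Omega>"
proof (cases "\<Omega> = {}")
  case False
  then obtain x where x: "x \<in> \<Omega>" by blast
  obtain K where K: "\<And>y. y \<in> \<Omega> \<Longrightarrow> gdist x y \<le> K" and "\<Omega> \<subseteq> V"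
    using assms x unfolding bounded_domain_def by blast
  have "(x, y) \<in> {(a, b). {a, b} \<in> E} ^^ gdist x y" if "y \<in> \<Omega>" for y
  proof -
    \<comment> \<open>\<open>gdist\<close> is a \<open>LEAST\<close>, so it is the length of an
      actual walk only once some walk is known; connectedness of the graph supplies one.\<close>
    have "\<exists>n. (x, y) \<in> {(a, b). {a, b} \<in> E} ^^ n"
      using connected[of x y] x that \<open>\<Omega> \<subseteq> V\<close> rtrancl_imp_relpow by blast
    then show ?thesis
      unfolding gdist_def by (rule LeastI_ex)
  qed
  then have "\<Omega> \<subseteq> (\<Union>n\<le>K. {y. (x, y) \<in> {(a, b). {a, b} \<in> E} ^^ n})"
    using K by blast
  then show ?thesis
    using finite_relpow_reach x \<open>\<Omega> \<subseteq> V\<close> by (meson finite_UN finite_atMost finite_subset subsetD)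
qed simp

section \<open>Linearity and continuity of the difference operators\<close>

lemma lap_add: "lap (\<lambda>x. u x + v x) x = lap u x + lap v x"
  by (simp add: lap_def algebra_simps sum.distrib sum_subtractf)

lemma lap_scale: "lap (\<lambda>x. c * u x) x = c * lap u x"
  unfolding lap_def sum_distrib_left by (rule sum.cong) (simp_all add: algebra_simps)

lemma grad_prod_add: "grad_prod (\<lambda>x. u x + v x) w x = grad_prod u w x + grad_prod v w x"
  by (simp add: grad_prod_def algebra_simps sum.distrib sum_subtractf)

lemma grad_prod_scale: "grad_prod (\<lambda>x. c * u x) w x = c * grad_prod u w x"
  unfolding grad_prod_def sum_distrib_left by (rule sum.cong) (simp_all add: algebra_simps)

lemma grad_prod_commute: "grad_prod u v x = grad_prod v u x"
  by (simp add: grad_prod_def mult_ac)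

lemma grad_prod_nonneg: "x \<in> V \<Longrightarrow> grad_prod u u x \<ge> 0"
  unfolding grad_prod_def mult.assoc
  by (intro mult_nonneg_nonneg sum_nonneg zero_le_square)
    (auto simp: less_imp_le \<mu>_pos weight_pos)

text \<open>The topology on functions is the product topology, that is, pointwise convergence. This
  choice gives compactness of the unit sphere later.\<close>

lemma continuous_on_eval: "continuous_on A (\<lambda>u :: 'a \<Rightarrow> real. u x)"
  by (rule continuous_on_subset[OF continuous_on_product_coordinates]) simp

lemma continuous_on_lap: "continuous_on A (\<lambda>u. lap u x)"
  unfolding lap_def
  by (intro continuous_intros continuous_on_eval)

lemma continuous_on_grad_prod: "continuous_on A (\<lambda>u. grad_prod u u x)"
  unfolding grad_prod_def
  by (intro continuous_intros continuous_on_eval)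

end

section \<open>The Hilbert space H over a finite domain\<close>

locale finite_domain = weighted_graph +
  fixes \<Omega> :: "'a set"
  assumes domain_subset: "\<Omega> \<subseteq> V"
    and finite_domain: "finite \<Omega>"
begin

lemma finite_bdry: "finite (bdry \<Omega>)"
proof (rule finite_subset)
  show "bdry \<Omega> \<subseteq> (\<Union>x\<in>\<Omega>. {y. {x, y} \<in> E})"
    by (auto simp: bdry_def)
  show "finite (\<Union>x\<in>\<Omega>. {y. {x, y} \<in> E})"
    using finite_domain domain_subset locally_finite by auto
qed

lemma integ_domain: "integ \<Omega> f = (\<Sum>x\<in>\<Omega>. \<mu> x * f x)"
  by (simp add: integ_def finite_domain)

lemma integ_closure: "integ (\<Omega> \<union> bdry \<Omega>) f = (\<Sum>x\<in>\<Omega> \<union> bdry \<Omega>. \<mu> x * f x)"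
  by (simp add: integ_def finite_domain finite_bdry)

lemma closure_subset_V: "\<Omega> \<union> bdry \<Omega> \<subseteq> V"
  using domain_subset bdry_subset by blast

text \<open>A function vanishing off \<Omega> already lies in \<open>Cc \<Omega>\<close>, so a
  constant sequence puts it in the completion; finite sums make its norm finite. Membership in
  \<open>H\<close> thus becomes a pure support condition.\<close>

lemma H_eq: "H \<Omega> = {u. \<forall>x. x \<notin> \<Omega> \<longrightarrow> u x = 0}"
proof
  show "H \<Omega> \<subseteq> {u. \<forall>x. x \<notin> \<Omega> \<longrightarrow> u x = 0}"
    by (auto simp: H_def W12_0_def)
  show "{u. \<forall>x. x \<notin> \<Omega> \<longrightarrow> u x = 0} \<subseteq> H \<Omega>"
  proof safe
    fix u :: "'a \<Rightarrow> real"
    assume u: "\<forall>x. x \<notin> \<Omega> \<longrightarrow> u x = 0"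
    then have v: "u \<in> vfuns"
      using domain_subset by (auto simp: vfuns_def)
    then have "u \<in> Cc \<Omega>"
      using u by (auto simp: Cc_def bdry_def)
    moreover have "norm_W12 \<Omega> (\<lambda>x. u x - u x) = 0"
      by (simp add: norm_W12_def integ_domain integ_closure grad_sq_def grad_prod_def)
    ultimately have "u \<in> W12_0 \<Omega>"
      using u v by (auto simp: W12_0_def intro!: exI[of _ "\<lambda>n. u"])
    then show "u \<in> H \<Omega>"
      using v by (simp add: H_def W22_def finite_domain finite_bdry)
  qed
qed

lemma H_scale: "u \<in> H \<Omega> \<Longrightarrow> (\<lambda>x. c * u x) \<in> H \<Omega>"
  by (simp add: H_eq)

lemma inner_H_sum:
  "inner_H \<Omega> u v = (\<Sum>x\<in>\<Omega> \<union> bdry \<Omega>. \<mu> x * (lap u x * lap v x + grad_prod u v x))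
     + (\<Sum>x\<in>\<Omega>. \<mu> x * (u x * v x))"
  by (simp add: inner_H_def integ_domain integ_closure)

lemma inner_H_commute: "inner_H \<Omega> u v = inner_H \<Omega> v u"
  by (simp add: inner_H_sum mult.commute grad_prod_commute)

lemma inner_H_add_left: "inner_H \<Omega> (\<lambda>x. u x + v x) w = inner_H \<Omega> u w + inner_H \<Omega> v w"
  by (simp add: inner_H_sum lap_add grad_prod_add algebra_simps sum.distrib)

lemma inner_H_scale_left: "inner_H \<Omega> (\<lambda>x. c * u x) w = c * inner_H \<Omega> u w"
  by (simp add: inner_H_sum lap_scale grad_prod_scale sum_distrib_left algebra_simps)

lemma inner_H_add_right: "inner_H \<Omega> w (\<lambda>x. u x + v x) = inner_H \<Omega> w u + inner_H \<Omega> w v"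
  by (metis inner_H_commute inner_H_add_left)

lemma inner_H_scale_right: "inner_H \<Omega> w (\<lambda>x. c * u x) = c * inner_H \<Omega> w u"
  by (metis inner_H_commute inner_H_scale_left)

lemma inner_H_ge_integ: "(\<Sum>x\<in>\<Omega>. \<mu> x * (u x)\<^sup>2) \<le> inner_H \<Omega> u u"
proof -
  have "0 \<le> \<mu> x * (lap u x * lap u x + grad_prod u u x)" if "x \<in> \<Omega> \<union> bdry \<Omega>" for x
  proof -
    have "x \<in> V" using that closure_subset_V by blast
    then show ?thesis using \<mu>_pos[of x] grad_prod_nonneg[of x u] by simp
  qed
  then have "0 \<le> (\<Sum>x\<in>\<Omega> \<union> bdry \<Omega>. \<mu> x * (lap u x * lap u x + grad_prod u u x))"
    by (rule sum_nonneg)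
  then show ?thesis
    by (simp add: inner_H_sum power2_eq_square)
qed

lemma inner_H_ge_point:
  assumes "x \<in> \<Omega>"
  shows "\<mu> x * (u x)\<^sup>2 \<le> inner_H \<Omega> u u"
proof -
  have "0 \<le> \<mu> y * (u y)\<^sup>2" if "y \<in> \<Omega>" for y
    using that \<mu>_pos[of y] domain_subset by auto
  then have "\<mu> x * (u x)\<^sup>2 \<le> (\<Sum>x\<in>\<Omega>. \<mu> x * (u x)\<^sup>2)"
    using assms finite_domain by (intro member_le_sum) auto
  then show ?thesis using inner_H_ge_integ[of u] by simp
qed

lemma inner_H_nonneg: "inner_H \<Omega> u u \<ge> 0"
proof -
  have "0 \<le> (\<Sum>x\<in>\<Omega>. \<mu> x * (u x)\<^sup>2)"
    using \<mu>_pos domain_subset by (intro sum_nonneg) (simp add: less_imp_le subset_iff)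
  then show ?thesis using inner_H_ge_integ[of u] by simp
qed

lemma inner_H_pos:
  assumes "u \<in> H \<Omega>" "u \<noteq> (\<lambda>_. 0)"
  shows "inner_H \<Omega> u u > 0"
proof -
  obtain x where x: "u x \<noteq> 0" using assms(2) by blast
  then have "x \<in> \<Omega>" using assms(1) by (auto simp: H_eq)
  then show ?thesis
    using inner_H_ge_point[of x u] \<mu>_pos[of x] domain_subset x
    by (smt (verit, ccfv_SIG) mult_pos_pos subsetD zero_less_power2)
qed

lemma norm_H_sq: "(norm_H \<Omega> u)\<^sup>2 = inner_H \<Omega> u u"
  by (simp add: norm_H_def inner_H_nonneg)

lemma norm_H_nonneg: "norm_H \<Omega> u \<ge> 0"
  by (simp add: norm_H_def inner_H_nonneg)

lemma norm_H_scale: "norm_H \<Omega> (\<lambda>x. c * u x) = \<bar>c\<bar> * norm_H \<Omega> u"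
  by (simp add: norm_H_def inner_H_scale_left inner_H_scale_right mult.assoc[symmetric]
      real_sqrt_mult)

text \<open>This plays the role of the Sobolev embedding into bounded functions: it turns a small
  norm into small values, and it bounds the unit sphere coordinatewise.\<close>

lemma abs_le_norm_H:
  assumes "x \<in> \<Omega>"
  shows "\<bar>u x\<bar> \<le> norm_H \<Omega> u / sqrt (\<mu> x)"
proof -
  have "sqrt (\<mu> x * (u x)\<^sup>2) \<le> norm_H \<Omega> u"
    unfolding norm_H_def using inner_H_ge_point[OF assms] by simp
  then show ?thesis
    using \<mu>_pos[of x] assms domain_subset by (auto simp: real_sqrt_mult field_simps)
qed

lemma continuous_on_inner_H: "continuous_on A (\<lambda>u. inner_H \<Omega> u u)"
  unfolding inner_H_sum
  by (intro continuous_intros continuous_on_lap continuous_on_grad_prod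
      continuous_on_eval)

text \<open>The usual discriminant argument. Since \<open>u\<close> and \<open>v\<close> need not
  lie in \<open>H\<close>, the form is only semidefinite here and B(v, v) = 0 is treated
  separately.\<close>

lemma Cauchy_Schwarz_H: "\<bar>inner_H \<Omega> u v\<bar> \<le> norm_H \<Omega> u * norm_H \<Omega> v"
proof -
  let ?B = "inner_H \<Omega>"
  have q: "0 \<le> ?B u u + 2 * c * ?B u v + c\<^sup>2 * ?B v v" for c
    using inner_H_nonneg[of "\<lambda>x. u x + c * v x"] inner_H_commute[of u v]
    by (simp add: inner_H_add_left inner_H_add_right inner_H_scale_left inner_H_scale_right
        power2_eq_square algebra_simps)
  have "(?B u v)\<^sup>2 \<le> ?B u u * ?B v v"
  proof (cases "?B v v = 0")
    case True
    have "?B u v = 0"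
    proof (rule ccontr)
      assume "?B u v \<noteq> 0"
      then show False
        \<comment> \<open>With B(v, v) = 0 the quadratic is affine in c; this c gives it the value
          -1.\<close>
        using q[of "- (?B u u + 1) / (2 * ?B u v)"] True inner_H_nonneg[of u] by (simp add: field_simps)
    qed
    then show ?thesis using True by simp
  next
    case False
    then have "?B v v > 0" using inner_H_nonneg[of v] by simp
    then show ?thesis
      \<comment> \<open>The minimiser of the quadratic in c.\<close>
      using q[of "- ?B u v / ?B v v"] by (simp add: power2_eq_square field_simps)
  qed
  then have "(?B u v)\<^sup>2 \<le> (norm_H \<Omega> u * norm_H \<Omega> v)\<^sup>2"
    by (simp add: power_mult_distrib norm_H_sq)
  then show ?thesis
    using abs_le_square_iff[of "?B u v" "norm_H \<Omega> u * norm_H \<Omega> v"] norm_H_nonneg[of u] norm_H_nonneg[of v]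
    by simp
qed

section \<open>The power term and its derivative\<close>

definition pmass :: "real \<Rightarrow> ('a \<Rightarrow> real) \<Rightarrow> real" where
  "pmass p u = (\<Sum>x\<in>\<Omega>. \<mu> x * \<bar>u x\<bar> powr p)"

text \<open>The right-hand side of the weak equation. For p > 2, p times it is the derivative of
  \<open>pmass p\<close> at \<open>u\<close> in the direction \<open>v\<close>.\<close>

definition pform :: "real \<Rightarrow> ('a \<Rightarrow> real) \<Rightarrow> ('a \<Rightarrow> real) \<Rightarrow> real" where
  "pform p u v = (\<Sum>x\<in>\<Omega>. \<mu> x * (\<bar>u x\<bar> powr (p - 2) * u x * v x))"

lemma J_eq: "J \<Omega> p u = inner_H \<Omega> u u / 2 - pmass p u / p"
  by (simp add: J_def inner_H_sum integ_domain integ_closure pmass_def grad_sq_def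
      power2_eq_square add_divide_distrib)

text \<open>Euler's identity for a p-homogeneous function. No condition on p arises, because
  \<open>powr\<close> takes the value 0 at base 0.\<close>

lemma pform_self: "pform p u u = pmass p u"
  unfolding pform_def pmass_def
proof (rule sum.cong)
  fix x
  have "\<bar>u x\<bar> powr (p - 2) * (u x * u x) = \<bar>u x\<bar> powr p"
  proof (cases "u x = 0")
    case False
    then have "\<bar>u x\<bar> powr (p - 2) * \<bar>u x\<bar> powr 2 = \<bar>u x\<bar> powr p"
      by (simp only: powr_add[symmetric]) simp
    then show ?thesis using False by (simp add: power2_eq_square[symmetric])
  qed simp
  then show "\<mu> x * (\<bar>u x\<bar> powr (p - 2) * u x * u x) = \<mu> x * \<bar>u x\<bar> powr p"
    by (simp add: mult.assoc)
qed simp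

lemma pmass_scale: "pmass p (\<lambda>x. c * u x) = \<bar>c\<bar> powr p * pmass p u"
  by (simp add: pmass_def abs_mult powr_mult sum_distrib_left mult_ac)

lemma pform_scale: "pform p (\<lambda>x. c * u x) v = \<bar>c\<bar> powr (p - 2) * c * pform p u v"
  by (simp add: pform_def abs_mult powr_mult sum_distrib_left mult_ac)

lemma pmass_pos:
  assumes "u \<in> H \<Omega>" "u \<noteq> (\<lambda>_. 0)"
  shows "pmass p u > 0"
proof -
  obtain x where x: "u x \<noteq> 0" using assms(2) by blast
  then have "x \<in> \<Omega>" using assms(1) by (auto simp: H_eq)
  then show ?thesis unfolding pmass_def
    using x \<mu>_pos domain_subset finite_domain
    by (intro sum_pos2[of _ x]) (auto simp: subset_iff less_imp_le)
qed

lemma continuous_on_pmass: "p > 0 \<Longrightarrow> continuous_on A (pmass p)"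
  unfolding pmass_def
  by (intro continuous_on_sum continuous_on_mult continuous_on_const continuous_on_powr'
      continuous_on_rabs continuous_on_eval) auto

lemma pmass_has_derivative_line:
  assumes "p > 2"
  shows "((\<lambda>s. pmass p (\<lambda>x. u x + s * v x)) has_real_derivative p * pform p u v) (at 0)"
proof -
  have "((\<lambda>s. \<bar>u x + s * v x\<bar> powr p) has_real_derivative
      p * (\<bar>u x\<bar> powr (p - 2) * u x) * v x) (at 0)" for x
  proof (rule DERIV_chain2[where f = "\<lambda>t. \<bar>t\<bar> powr p"])
    show "((\<lambda>t. \<bar>t\<bar> powr p) has_real_derivative p * (\<bar>u x\<bar> powr (p - 2) * u x)) (at (u x + 0 * v x))"
      using has_real_derivative_abs_powr[OF assms, of "u x"] by simp
    show "((\<lambda>s. u x + s * v x) has_real_derivative v x) (at 0)"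
      by (auto intro!: derivative_eq_intros)
  qed
  then show ?thesis
    unfolding pmass_def pform_def sum_distrib_left
    by (intro DERIV_sum) (auto intro!: DERIV_cong[OF DERIV_cmult])
qed

lemma inner_H_has_derivative_line:
  "((\<lambda>s. inner_H \<Omega> (\<lambda>x. u x + s * v x) (\<lambda>x. u x + s * v x))
     has_real_derivative 2 * inner_H \<Omega> u v) (at 0)"
  unfolding inner_H_add_left inner_H_add_right inner_H_scale_left inner_H_scale_right
    inner_H_commute[of v u]
  by (auto intro!: derivative_eq_intros)

text \<open>The scalar derivative bounds the remainder at each point by a multiple of |h x|. As
  \<Omega> is finite, \<open>abs_le_norm_H\<close> makes these bounds uniform in the norm of
  \<open>h\<close>.\<close>

lemma pmass_frechet:
  assumes "p > 2" "e > 0"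
  shows "\<exists>d>0. \<forall>h. norm_H \<Omega> h < d \<longrightarrow>
    \<bar>pmass p (\<lambda>x. u x + h x) - pmass p u - p * pform p u h\<bar> \<le> e * norm_H \<Omega> h"
proof -
  \<comment> \<open>The weight \<mu> x times the factor 1 / sqrt (\<mu> x) of the embedding leaves
    sqrt (\<mu> x), so pointwise tolerance e / M sums to at most e. The summand 1 keeps M
    positive.\<close>
  define M where "M = (\<Sum>x\<in>\<Omega>. sqrt (\<mu> x)) + 1"
  have pos: "\<mu> x > 0" if "x \<in> \<Omega>" for x
    using that \<mu>_pos domain_subset by blast
  have "M > 0"
    unfolding M_def using pos by (intro add_nonneg_pos sum_nonneg) (auto simp: less_imp_le)
  let ?r = "\<lambda>x s. \<bar>u x + s\<bar> powr p - \<bar>u x\<bar> powr p - p * (\<bar>u x\<bar> powr (p - 2) * u x) * s"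
  have "\<exists>d>0. \<forall>s. \<bar>s\<bar> < d \<longrightarrow> \<bar>?r x s\<bar> \<le> e / M * \<bar>s\<bar>" for x
  proof -
    have "e / M > 0" using \<open>M > 0\<close> \<open>e > 0\<close> by simp
    then obtain d where "d > 0" and d: "\<And>y. norm (y - u x) < d \<Longrightarrow> norm (\<bar>y\<bar> powr p - \<bar>u x\<bar> powr p -
        p * (\<bar>u x\<bar> powr (p - 2) * u x) * (y - u x)) \<le> e / M * norm (y - u x)"
      using has_real_derivative_abs_powr[OF assms(1), of "u x"]
      unfolding has_field_derivative_def has_derivative_at_alt by blast
    then show ?thesis
      using d[of "u x + s" for s] by (intro exI[of _ d]) simp
  qed
  then obtain d where d: "\<And>x. d x > 0" "\<And>x s. \<bar>s\<bar> < d x \<Longrightarrow> \<bar>?r x s\<bar> \<le> e / M * \<bar>s\<bar>"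
    by metis
  \<comment> \<open>A norm below D forces |h x| < d x at every point of \<Omega>. The 1 keeps the
    set nonempty when \<Omega> is empty.\<close>
  define D where "D = Min (insert 1 ((\<lambda>x. d x * sqrt (\<mu> x)) ` \<Omega>))"
  have "D > 0"
    unfolding D_def using d(1) pos finite_domain by auto
  have "\<bar>pmass p (\<lambda>x. u x + h x) - pmass p u - p * pform p u h\<bar> \<le> e * norm_H \<Omega> h"
    if h: "norm_H \<Omega> h < D" for h
  proof -
    have "\<bar>?r x (h x)\<bar> * \<mu> x \<le> e / M * norm_H \<Omega> h * sqrt (\<mu> x)" if x: "x \<in> \<Omega>" for x
    proof -
      note le = abs_le_norm_H[OF x, of h]
      have "D \<le> d x * sqrt (\<mu> x)"
        unfolding D_def using x finite_domain by (intro Min_le) auto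
      then have "norm_H \<Omega> h / sqrt (\<mu> x) < d x"
        using h pos[OF x] by (simp add: field_simps)
      then have "\<bar>?r x (h x)\<bar> \<le> e / M * \<bar>h x\<bar>"
        using le by (intro d(2)) simp
      also have "\<dots> \<le> e / M * (norm_H \<Omega> h / sqrt (\<mu> x))"
        using le \<open>M > 0\<close> \<open>e > 0\<close> by (intro mult_left_mono) auto
      finally have "\<bar>?r x (h x)\<bar> * \<mu> x \<le> e / M * (norm_H \<Omega> h / sqrt (\<mu> x)) * \<mu> x"
        using pos[OF x] by (intro mult_right_mono) auto
      also have "\<dots> = e / M * norm_H \<Omega> h * (\<mu> x / sqrt (\<mu> x))"
        by simp
      also have "\<mu> x / sqrt (\<mu> x) = sqrt (\<mu> x)"
        using pos[OF x] by (simp add: real_div_sqrt)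
      finally show ?thesis .
    qed
    moreover have "pmass p (\<lambda>x. u x + h x) - pmass p u - p * pform p u h
        = (\<Sum>x\<in>\<Omega>. ?r x (h x) * \<mu> x)"
      unfolding pmass_def pform_def sum_distrib_left sum_subtractf[symmetric]
      by (rule sum.cong) (simp_all add: algebra_simps)
    ultimately have "\<bar>pmass p (\<lambda>x. u x + h x) - pmass p u - p * pform p u h\<bar>
        \<le> (\<Sum>x\<in>\<Omega>. e / M * norm_H \<Omega> h * sqrt (\<mu> x))"
      using pos by (auto intro!: order_trans[OF sum_abs] sum_mono simp: abs_mult abs_of_pos)
    also have "\<dots> = e * norm_H \<Omega> h * ((M - 1) / M)"
      unfolding sum_distrib_left[symmetric] by (simp add: M_def)
    also have "\<dots> \<le> e * norm_H \<Omega> h * 1"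
      using \<open>M > 0\<close> \<open>e > 0\<close> norm_H_nonneg[of h] by (intro mult_left_mono) auto
    finally show ?thesis by simp
  qed
  then show ?thesis using \<open>D > 0\<close> by blast
qed

lemma pform_bounded: "\<exists>K. \<forall>v. \<bar>pform p u v\<bar> \<le> K * norm_H \<Omega> v"
proof -
  define K where "K = (\<Sum>x\<in>\<Omega>. \<bar>\<mu> x * (\<bar>u x\<bar> powr (p - 2) * u x)\<bar> / sqrt (\<mu> x))"
  have "\<bar>pform p u v\<bar> \<le> K * norm_H \<Omega> v" for v
  proof -
    have "\<bar>pform p u v\<bar> \<le> (\<Sum>x\<in>\<Omega>. \<bar>\<mu> x * (\<bar>u x\<bar> powr (p - 2) * u x)\<bar> * \<bar>v x\<bar>)"
      unfolding pform_def by (rule order_trans[OF sum_abs]) (simp add: abs_mult mult_ac)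
    also have "\<dots> \<le> (\<Sum>x\<in>\<Omega>. \<bar>\<mu> x * (\<bar>u x\<bar> powr (p - 2) * u x)\<bar> * (norm_H \<Omega> v / sqrt (\<mu> x)))"
      by (intro sum_mono mult_left_mono abs_le_norm_H) auto
    also have "\<dots> = K * norm_H \<Omega> v"
      by (simp add: K_def sum_distrib_right)
    finally show ?thesis .
  qed
  then show ?thesis by blast
qed

section \<open>The derivative of J and the Nehari set\<close>

lemma J_has_H_derivative:
  assumes p: "p > 2"
  shows "has_H_derivative \<Omega> (J \<Omega> p) (\<lambda>v. inner_H \<Omega> u v - pform p u v) u"
proof -
  let ?L = "\<lambda>v. inner_H \<Omega> u v - pform p u v"
  have "\<exists>K. \<forall>v\<in>H \<Omega>. \<bar>?L v\<bar> \<le> K * norm_H \<Omega> v"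
  proof -
    obtain K where K: "\<And>v. \<bar>pform p u v\<bar> \<le> K * norm_H \<Omega> v"
      using pform_bounded by blast
    have "\<bar>?L v\<bar> \<le> (norm_H \<Omega> u + K) * norm_H \<Omega> v" for v
      using K[of v] Cauchy_Schwarz_H[of u v] by (simp add: algebra_simps)
    then show ?thesis by blast
  qed
  moreover have "\<exists>d>0. \<forall>h\<in>H \<Omega>. norm_H \<Omega> h < d \<longrightarrow>
      \<bar>J \<Omega> p (\<lambda>x. u x + h x) - J \<Omega> p u - ?L h\<bar> \<le> e * norm_H \<Omega> h" if "e > 0" for e
  proof -
    obtain d where d: "d > 0" "\<And>h. norm_H \<Omega> h < d \<Longrightarrow>
        \<bar>pmass p (\<lambda>x. u x + h x) - pmass p u - p * pform p u h\<bar> \<le> e / 2 * norm_H \<Omega> h"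
      using pmass_frechet[OF p, of "e / 2" u] \<open>e > 0\<close> by auto
    \<comment> \<open>Radius d controls the remainder of \<open>pmass\<close>; radius e controls the
      exact quadratic remainder, half the squared norm. Each contributes at most e / 2 times the
      norm.\<close>
    have "\<bar>J \<Omega> p (\<lambda>x. u x + h x) - J \<Omega> p u - ?L h\<bar> \<le> e * norm_H \<Omega> h"
      if h: "norm_H \<Omega> h < min d e" for h
    proof -
      define R where "R = pmass p (\<lambda>x. u x + h x) - pmass p u - p * pform p u h"
      have "\<bar>R\<bar> \<le> e / 2 * norm_H \<Omega> h"
        unfolding R_def using d(2) h by simp
      moreover have "\<bar>R / p\<bar> \<le> \<bar>R\<bar>"
        using p by (simp add: divide_le_eq mult_le_cancel_left1)
      moreover have "norm_H \<Omega> h * norm_H \<Omega> h \<le> e * norm_H \<Omega> h"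
        using h norm_H_nonneg[of h] by (intro mult_right_mono) auto
      moreover have "J \<Omega> p (\<lambda>x. u x + h x) - J \<Omega> p u - ?L h = (norm_H \<Omega> h)\<^sup>2 / 2 - R / p"
        using p inner_H_commute[of u h] unfolding J_eq R_def norm_H_sq
        by (simp add: inner_H_add_left inner_H_add_right field_simps)
      moreover have "0 \<le> norm_H \<Omega> h * norm_H \<Omega> h"
        by simp
      ultimately show ?thesis
        unfolding power2_eq_square by linarith
    qed
    then show ?thesis using d(1) \<open>e > 0\<close> by (intro exI[of _ "min d e"]) auto
  qed
  ultimately show ?thesis
    unfolding has_H_derivative_def
    by (simp add: inner_H_add_right inner_H_scale_right pform_def algebra_simps sum.distrib
        sum_distrib_left)
qed

text \<open>The difference of two derivatives is linear and of smaller order than the norm, hence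
  zero along every ray. This is needed because \<open>nehari\<close> quantifies existentially over
  the derivative.\<close>

lemma has_H_derivative_unique:
  assumes L: "has_H_derivative \<Omega> F L u" and L': "has_H_derivative \<Omega> F L' u"
    and h: "h \<in> H \<Omega>"
  shows "L h = L' h"
proof (rule ccontr)
  assume ne: "L h \<noteq> L' h"
  \<comment> \<open>A positive bound for the norm, safe as a divisor. With e a third of the gap
    divided by N, the two remainders together stay below the gap.\<close>
  define N where "N = norm_H \<Omega> h + 1"
  have "N > 0" using norm_H_nonneg[of h] by (simp add: N_def)
  define e where "e = \<bar>L h - L' h\<bar> / (3 * N)"
  have "e > 0" using ne \<open>N > 0\<close> by (simp add: e_def)
  obtain d where d: "d > 0" "\<And>k. k \<in> H \<Omega> \<Longrightarrow> norm_H \<Omega> k < d \<Longrightarrow>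
      \<bar>F (\<lambda>x. u x + k x) - F u - L k\<bar> \<le> e * norm_H \<Omega> k"
    using L \<open>e > 0\<close> unfolding has_H_derivative_def by blast
  obtain d' where d': "d' > 0" "\<And>k. k \<in> H \<Omega> \<Longrightarrow> norm_H \<Omega> k < d' \<Longrightarrow>
      \<bar>F (\<lambda>x. u x + k x) - F u - L' k\<bar> \<le> e * norm_H \<Omega> k"
    using L' \<open>e > 0\<close> unfolding has_H_derivative_def by blast
  \<comment> \<open>Scales \<open>h\<close> into both neighbourhoods, strictly because N exceeds the
    norm.\<close>
  define c where "c = min d d' / N"
  have "c > 0" using d d' \<open>N > 0\<close> by (simp add: c_def)
  let ?k = "\<lambda>x. c * h x"
  have "c * norm_H \<Omega> h < c * N"
    using \<open>c > 0\<close> by (simp add: N_def)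
  also have "c * N = min d d'"
    using \<open>N > 0\<close> by (simp add: c_def)
  finally have k: "norm_H \<Omega> ?k < d" "norm_H \<Omega> ?k < d'"
    using \<open>c > 0\<close> by (simp_all add: norm_H_scale)
  have "L ?k = c * L h" "L' ?k = c * L' h"
    using L L' h unfolding has_H_derivative_def by blast+
  then have "\<bar>c * L h - c * L' h\<bar> \<le> 2 * e * norm_H \<Omega> ?k"
    using d(2)[OF H_scale[OF h] k(1)] d'(2)[OF H_scale[OF h] k(2)] by simp
  then have "c * \<bar>L h - L' h\<bar> \<le> c * (2 * e * norm_H \<Omega> h)"
    using \<open>c > 0\<close> by (simp add: norm_H_scale right_diff_distrib[symmetric] abs_mult)
  then have "\<bar>L h - L' h\<bar> \<le> 2 * e * norm_H \<Omega> h"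
    using \<open>c > 0\<close> by simp
  also have "\<dots> \<le> 2 * e * N"
    using \<open>e > 0\<close> by (simp add: N_def)
  also have "\<dots> < 3 * e * N"
    using \<open>e > 0\<close> \<open>N > 0\<close> by simp
  also have "\<dots> = \<bar>L h - L' h\<bar>"
    using \<open>N > 0\<close> by (simp add: e_def)
  finally show False by simp
qed

lemma nehari_eq:
  assumes "p > 2"
  shows "nehari \<Omega> p = {u \<in> H \<Omega> - {\<lambda>_. 0}. inner_H \<Omega> u u = pmass p u}"
proof -
  have "(\<exists>L. has_H_derivative \<Omega> (J \<Omega> p) L u \<and> L u = 0) \<longleftrightarrow> inner_H \<Omega> u u = pmass p u"
    if "u \<in> H \<Omega>" for u
  proof
    assume "\<exists>L. has_H_derivative \<Omega> (J \<Omega> p) L u \<and> L u = 0"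
    then obtain L where "has_H_derivative \<Omega> (J \<Omega> p) L u" "L u = 0" by blast
    then show "inner_H \<Omega> u u = pmass p u"
      using has_H_derivative_unique[OF J_has_H_derivative[OF assms] _ that] by (fastforce simp: pform_self)
  next
    assume "inner_H \<Omega> u u = pmass p u"
    then show "\<exists>L. has_H_derivative \<Omega> (J \<Omega> p) L u \<and> L u = 0"
      using J_has_H_derivative[OF assms, of u] pform_self[of p u]
      by (intro exI[of _ "\<lambda>v. inner_H \<Omega> u v - pform p u v"]) simp
  qed
  then show ?thesis by (auto simp: nehari_def)
qed

section \<open>The extremal problem on the unit sphere\<close>

text \<open>The sphere is a closed subset of a product of compact sets, which is compact by
  Tychonoff even if the ambient type is infinite.\<close>

lemma compact_unit_sphere: "compact {u \<in> H \<Omega>. inner_H \<Omega> u u = 1}"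
proof -
  \<comment> \<open>The intervals come from \<open>abs_le_norm_H\<close> at norm 1; the factors {0}
    encode vanishing off \<Omega>.\<close>
  let ?K = "\<Pi>\<^sub>E x\<in>UNIV. if x \<in> \<Omega> then {- 1 / sqrt (\<mu> x)..1 / sqrt (\<mu> x)} else {0::real}"
  have "compactin (product_topology (\<lambda>_::'a. euclidean) UNIV) ?K"
    by (subst compactin_PiE) (auto simp: compactin_euclidean_iff)
  then have "compact ?K"
    by (simp add: euclidean_product_topology)
  moreover have "closed {u. inner_H \<Omega> u u = 1}"
    using continuous_on_inner_H by (intro closed_Collect_eq) auto
  ultimately have "compact (?K \<inter> {u. inner_H \<Omega> u u = 1})"
    by (rule compact_Int_closed)
  moreover have "{u \<in> H \<Omega>. inner_H \<Omega> u u = 1} = ?K \<inter> {u. inner_H \<Omega> u u = 1}"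
  proof -
    have "- 1 / sqrt (\<mu> x) \<le> u x \<and> u x \<le> 1 / sqrt (\<mu> x)"
      if "inner_H \<Omega> u u = 1" "x \<in> \<Omega>" for u x
      using abs_le_norm_H[OF that(2), of u] that(1) by (simp add: norm_H_def abs_le_iff)
    then show ?thesis
      by (auto simp: H_eq PiE_iff split: if_splits)
  qed
  ultimately show ?thesis by simp
qed

text \<open>S is the maximum of \<open>pmass p\<close> on the sphere. Normalising a nonzero
  \<open>w\<close> and using homogeneity makes it the best constant in the inequality on all of
  \<open>H\<close>.\<close>

lemma Sobolev_extremal:
  assumes "p > 0" "\<Omega> \<noteq> {}"
  obtains v S where "v \<in> H \<Omega>" "inner_H \<Omega> v v = 1" "pmass p v = S" "S > 0"
    "\<And>w. w \<in> H \<Omega> \<Longrightarrow> pmass p w \<le> S * inner_H \<Omega> w w powr (p / 2)"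
proof -
  let ?S = "{u \<in> H \<Omega>. inner_H \<Omega> u u = 1}"
  have normalise: "(\<lambda>x. 1 / norm_H \<Omega> w * w x) \<in> ?S"
    if "w \<in> H \<Omega>" "w \<noteq> (\<lambda>_. 0)" for w
  proof -
    have "norm_H \<Omega> w > 0" using inner_H_pos[OF that] by (simp add: norm_H_def)
    then show ?thesis
      using H_scale[OF that(1), of "1 / norm_H \<Omega> w"]
      unfolding mem_Collect_eq norm_H_sq[symmetric] norm_H_scale by simp
  qed
  obtain z where z: "z \<in> \<Omega>" using assms(2) by blast
  \<comment> \<open>A point mass, once normalised, shows that the sphere is nonempty.\<close>
  have "indicator {z} \<in> H \<Omega>" "indicator {z} \<noteq> (\<lambda>_. 0::real)"
    using z by (auto simp: H_eq indicator_def fun_eq_iff)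
  then have "?S \<noteq> {}" using normalise by blast
  then obtain v where v: "v \<in> ?S" "\<And>w. w \<in> ?S \<Longrightarrow> pmass p w \<le> pmass p v"
    using continuous_attains_sup[OF compact_unit_sphere _ continuous_on_pmass[OF assms(1)]] by blast
  have "v \<noteq> (\<lambda>_. 0)"
    using v(1) by (auto simp: inner_H_sum lap_def grad_prod_def)
  then have "pmass p v > 0" using v(1) pmass_pos by blast
  moreover have "pmass p w \<le> pmass p v * inner_H \<Omega> w w powr (p / 2)" if "w \<in> H \<Omega>" for w
  proof (cases "w = (\<lambda>_. 0)")
    case True
    then show ?thesis using \<open>pmass p v > 0\<close> by (simp add: pmass_def)
  next
    case False
    have N: "norm_H \<Omega> w > 0" using inner_H_pos[OF that False] by (simp add: norm_H_def)
    have "(1 / norm_H \<Omega> w) powr p * pmass p w \<le> pmass p v"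
      using v(2)[OF normalise[OF that False]] N by (simp only: pmass_scale) simp
    then have "pmass p w \<le> pmass p v * norm_H \<Omega> w powr p"
      using N by (simp add: powr_divide field_simps)
    also have "norm_H \<Omega> w powr p = inner_H \<Omega> w w powr (p / 2)"
      using inner_H_pos[OF that False] by (simp add: norm_H_def powr_half_sqrt[symmetric] powr_powr)
    finally show ?thesis .
  qed
  ultimately show ?thesis using that v(1) by blast
qed

text \<open>The defect of the inequality is nonpositive on all of \<open>H\<close> and zero at
  \<open>v\<close>, so it has an unconstrained maximum along each line through
  \<open>v\<close>.\<close>

lemma Sobolev_Euler_Lagrange:
  assumes p: "p > 2" and v: "v \<in> H \<Omega>" "inner_H \<Omega> v v = 1" "pmass p v = S"
    and max: "\<And>w. w \<in> H \<Omega> \<Longrightarrow> pmass p w \<le> S * inner_H \<Omega> w w powr (p / 2)"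
    and \<phi>: "\<phi> \<in> H \<Omega>"
  shows "pform p v \<phi> = S * inner_H \<Omega> v \<phi>"
proof -
  let ?w = "\<lambda>s x. v x + s * \<phi> x"
  let ?f = "\<lambda>s. pmass p (?w s) - S * inner_H \<Omega> (?w s) (?w s) powr (p / 2)"
  \<comment> \<open>Since B(v, v) = 1, the outer derivative of the power p/2 is p/2, which cancels
    the 2 of the quadratic form.\<close>
  have "(?f has_real_derivative p * pform p v \<phi> - S * (p * inner_H \<Omega> v \<phi>)) (at 0)"
    by (rule derivative_eq_intros pmass_has_derivative_line[OF p] inner_H_has_derivative_line refl
        | simp add: v)+
  moreover have "?f s \<le> ?f 0" for s
    using max[of "?w s"] v \<phi> by (simp add: H_eq)
  ultimately have "p * pform p v \<phi> - S * (p * inner_H \<Omega> v \<phi>) = 0"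
    by (intro DERIV_local_max[of ?f _ 0 1]) auto
  then show ?thesis using p by simp
qed

section \<open>The ground state\<close>

lemma ground_state_exists:
  assumes p: "p > 2" and ne: "\<Omega> \<noteq> {}"
  shows "\<exists>u\<in>H \<Omega>. ground_state_solution \<Omega> p u"
proof -
  obtain v S where v: "v \<in> H \<Omega>" "inner_H \<Omega> v v = 1" "pmass p v = S" and S: "S > 0"
    and max: "\<And>w. w \<in> H \<Omega> \<Longrightarrow> pmass p w \<le> S * inner_H \<Omega> w w powr (p / 2)"
    using Sobolev_extremal[of p] p ne by auto
  \<comment> \<open>Replacing \<open>v\<close> by t v scales \<open>pform\<close> by t^(p-1) and the
    inner product by t. The factor S therefore disappears exactly when t^(p-2) S = 1.\<close>
  define t where "t = S powr (- 1 / (p - 2))"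
  have t: "t > 0" using S by (simp add: t_def)
  have tS: "t powr (p - 2) * S = 1"
    using S p unfolding t_def powr_powr by (simp add: powr_minus)
  define u where "u = (\<lambda>x. t * v x)"
  have uH: "u \<in> H \<Omega>" unfolding u_def by (rule H_scale[OF v(1)])
  have Buu: "inner_H \<Omega> u u = t\<^sup>2"
    by (simp add: u_def inner_H_scale_left inner_H_scale_right v power2_eq_square)
  have EL: "pform p u \<phi> = inner_H \<Omega> u \<phi>" if "\<phi> \<in> H \<Omega>" for \<phi>
  proof -
    have "pform p u \<phi> = (t powr (p - 2) * S) * (t * inner_H \<Omega> v \<phi>)"
      using t Sobolev_Euler_Lagrange[OF p v max that] by (simp add: u_def pform_scale)
    then show ?thesis by (simp add: tS u_def inner_H_scale_left)
  qed
  have "u \<noteq> (\<lambda>_. 0)"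
    using Buu t by (auto simp: inner_H_sum lap_def grad_prod_def)
  moreover have "inner_H \<Omega> u u = pmass p u"
    using EL[OF uH] by (simp add: pform_self)
  ultimately have uN: "u \<in> nehari \<Omega> p"
    using uH by (simp add: nehari_eq[OF p])
  have J_nehari: "J \<Omega> p w = (1 / 2 - 1 / p) * inner_H \<Omega> w w" if "w \<in> nehari \<Omega> p" for w
    using that by (simp add: nehari_eq[OF p] J_eq algebra_simps)
  have "J \<Omega> p u \<le> J \<Omega> p w" if w: "w \<in> nehari \<Omega> p" for w
  proof -
    define b where "b = inner_H \<Omega> w w"
    have wH: "w \<in> H \<Omega>" "b = pmass p w" and "b > 0"
      using w inner_H_pos[of w] by (auto simp: nehari_eq[OF p] b_def)
    \<comment> \<open>On the Nehari set the Sobolev inequality bounds b by a higher power of itself.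
      Dividing by b > 0 bounds b from below by t^2, the value attained at \<open>u\<close>.\<close>
    have "b \<le> S * b powr (p / 2)"
      using max[OF wH(1)] wH(2) by (simp add: b_def)
    also have "b powr (p / 2) = b * b powr ((p - 2) / 2)"
      using \<open>b > 0\<close> powr_add[of b 1 "(p - 2) / 2"] by (simp add: field_simps)
    finally have "1 \<le> S * b powr ((p - 2) / 2)"
      using \<open>b > 0\<close> by (simp add: field_simps)
    then have "t powr (p - 2) * S \<le> b powr ((p - 2) / 2) * S"
      using tS by (simp add: mult.commute)
    then have "t powr (p - 2) \<le> b powr ((p - 2) / 2)"
      using S by simp
    also have "t powr (p - 2) = (t\<^sup>2) powr ((p - 2) / 2)"
    proof -
      have "(t powr 2) powr ((p - 2) / 2) = t powr (p - 2)"
        unfolding powr_powr by (rule arg_cong[where f = "(powr) t"]) (simp add: field_simps)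
      then show ?thesis using t by simp
    qed
    finally have "t\<^sup>2 \<le> b"
      using p \<open>b > 0\<close> powr_less_mono2[of "(p - 2) / 2" b "t\<^sup>2"]
      by (cases "b < t\<^sup>2") simp_all
    then show ?thesis
      unfolding J_nehari[OF uN] J_nehari[OF w] Buu b_def[symmetric]
      using p by (intro mult_left_mono) (auto simp: field_simps)
  qed
  then have "ground_level \<Omega> p = J \<Omega> p u"
    unfolding ground_level_def using uN by (intro cInf_eq_minimum) auto
  moreover have "critical_point \<Omega> p u"
  proof -
    have "inner_H \<Omega> u h - pform p u h = 0" if "h \<in> H \<Omega>" for h
      using EL[OF that] by simp
    then show ?thesis
      \<comment> \<open>The derivative of J agrees with the zero functional on \<open>H\<close>
        only, which suffices because every clause of \<open>has_H_derivative\<close> is restricted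
        to \<open>H\<close>. The bound for the zero functional takes K = 0.\<close>
      using J_has_H_derivative[OF p, of u] uH
      unfolding critical_point_def has_H_derivative_def by (simp add: exI[of _ 0])
  qed
  moreover have "weak_solution \<Omega> p u"
    using uH EL by (simp add: weak_solution_def inner_H_def integ_domain pform_def)
  ultimately show ?thesis
    using uH uN by (auto simp: ground_state_solution_def)
qed

end

theorem theorem1p2:
  fixes V :: "'a set" and E :: "'a set set"
    and \<mu> :: "'a \<Rightarrow> real" and \<omega> :: "'a \<Rightarrow> 'a \<Rightarrow> real"
    and \<Omega> :: "'a set" and p :: real
  assumes "weighted_graph V E \<mu> \<omega>"
    and "weighted_graph.bounded_domain V E \<Omega>"
    and "weighted_graph.connected_domain E \<Omega>"
    and "\<Omega> \<noteq> {}"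
    and "p > 2"
  shows "\<exists>u\<^sub>0 \<in> weighted_graph.H V E \<mu> \<omega> \<Omega>.
           weighted_graph.ground_state_solution V E \<mu> \<omega> \<Omega> p u\<^sub>0"
proof -
  interpret weighted_graph V E \<mu> \<omega> by fact
  interpret finite_domain V E \<mu> \<omega> \<Omega>
  proof
    show "\<Omega> \<subseteq> V" using assms(2) by (simp add: bounded_domain_def)
    show "finite \<Omega>" by (rule bounded_domain_finite[OF assms(2)])
  qed
  show ?thesis by (rule ground_state_exists[OF assms(5,4)])
qed

end
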